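(* Let $A \in M_n(\mathbb{C})$. Then $X = A^{\dagger}A^{d}A^{\dagger}$ is the unique matrix $X \in M_n(\mathbb{C})$ satisfying the three equations $$XA^{3}X = X,\qquad AX = A^{d}A^{\dagger},\qquad XA = A^{\dagger}A^{d}.$$
   Context: $M_n(\mathbb{C})$ is the set of complex $n\times n$ matrices. $A^{\dagger}$ is the Moore-Penrose inverse of $A$. $A^{d}$ is the Drazin inverse of $A$: the unique $X$ with $A^{k+1}X=A^{k}$, $XAX=X$, $AX=XA$, where $k=\mathrm{Ind}(A)$ is the smallest non-negative integer with $\mathrm{rank}(A^{k})=\mathrm{rank}(A^{k+1})$. *)

theory Defs
  imports "HOL-Analysis.Analysis"
begin

(* The instance of times for 'a ^ 'n multiplies componentwise, so A ^ k is not the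
   power of A with respect to the matrix product. *)
primrec matpow :: "'a::semiring_1 ^'n^'n \<Rightarrow> nat \<Rightarrow> 'a^'n^'n" where
  "matpow A 0 = mat 1"
| "matpow A (Suc k) = A ** matpow A k"

definition conjugate_transpose :: "complex^'n^'m \<Rightarrow> complex^'m^'n" where
  "conjugate_transpose A = (\<chi> i j. cnj (A $ j $ i))"

definition is_moore_penrose_inverse :: "complex^'n^'m \<Rightarrow> complex^'m^'n \<Rightarrow> bool" where
  "is_moore_penrose_inverse A X \<longleftrightarrow>
     A ** X ** A = A \<and>
     X ** A ** X = X \<and>
     conjugate_transpose (A ** X) = A ** X \<and>
     conjugate_transpose (X ** A) = X ** A"

definition moore_penrose_inverse :: "complex^'n^'m \<Rightarrow> complex^'m^'n" where
  "moore_penrose_inverse A = (THE X. is_moore_penrose_inverse A X)"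

definition matrix_index :: "complex^'n^'n \<Rightarrow> nat" where
  "matrix_index A = (LEAST k. rank (matpow A k) = rank (matpow A (k + 1)))"

definition is_drazin_inverse :: "complex^'n^'n \<Rightarrow> complex^'n^'n \<Rightarrow> bool" where
  "is_drazin_inverse A X \<longleftrightarrow>
     matpow A (matrix_index A + 1) ** X = matpow A (matrix_index A) \<and>
     X ** A ** X = X \<and>
     A ** X = X ** A"

definition drazin_inverse :: "complex^'n^'n \<Rightarrow> complex^'n^'n" where
  "drazin_inverse A = (THE X. is_drazin_inverse A X)"

end

theory Submission
  imports Defs
begin

text \<open>
  The formula $X = A^\dagger A^d A^\dagger$ satisfies the equations by cancellation alone, because
  $A^d = A (A^d)^2 = (A^d)^2 A$; conversely the equations give
  $X = (XA) A (AX) = A^\dagger A^d A A^d A^\dagger = A^\dagger A^d A^\dagger$.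
  The remaining work is that both inverses exist. For the Moore-Penrose inverse, $A^* A$ and $A$ have
  the same kernel, so $A = Z A^* A$; likewise $A^* = V A A^*$, and $A^\dagger = V A Z^*$. For the
  Drazin inverse, equality of ranks at the index $k$ gives $A^k = Z A^{2k+1} = A^{2k+1} Y$, and
  $A^d = Z A^k = A^k Y$.
\<close>

section \<open>Factorization of matrices\<close>

lemma column_eq_mult_axis: "column i B = (B :: 'a::semiring_1^'n^'m) *v axis i 1"
  by (simp add: vec_eq_iff column_def matrix_vector_mult_def axis_def if_distrib cong: if_cong)

text \<open>Preimages under \<open>C\<close> of the columns of \<open>B\<close>, placed side by
  side, form \<open>Y\<close>.\<close>

lemma matrix_right_factor:
  fixes B :: "'a::field^'n^'m" and C :: "'a^'p^'m"
  assumes "range ((*v) B) \<subseteq> range ((*v) C)"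
  obtains Y where "B = C ** Y"
proof -
  have "\<forall>i. \<exists>y. column i B = C *v y"
    using assms by (metis column_eq_mult_axis rangeE rangeI subsetD)
  then obtain y where y: "\<And>i. column i B = C *v y i"
    by metis
  have "B = C ** (\<chi> j i. y i $ j)"
    using y by (simp add: vec_eq_iff column_def matrix_matrix_mult_def matrix_vector_mult_def)
  then show thesis ..
qed

text \<open>A generalized inverse \<open>G\<close> of \<open>B\<close>, with
  \<open>B G B = B\<close>, puts \<open>x - G B x\<close> in the kernel of \<open>B\<close>, hence
  in that of \<open>C\<close>; so \<open>C = C G B\<close>.\<close>

lemma matrix_left_factor:
  fixes B :: "'a::field^'n^'m" and C :: "'a^'n^'p"
  assumes "\<And>x. B *v x = 0 \<Longrightarrow> C *v x = 0"
  obtains Z where "C = Z ** B"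
proof -
  obtain g where g: "Vector_Spaces.linear (*s) (*s) g" "\<And>x. B *v g (B *v x) = B *v x"
    using vec.linear_exists_right_inverse_on[OF matrix_vector_mul_linear_gen[of B] vec.subspace_UNIV]
    by auto
  define G where "G = matrix g"
  have "B *v (x - G *v (B *v x)) = 0" for x
    by (simp add: G_def matrix_works[OF g(1)] g(2) matrix_vector_mult_diff_distrib)
  then have "C *v (x - G *v (B *v x)) = 0" for x
    using assms by blast
  then have "C = (C ** G) ** B"
    by (simp add: matrix_eq matrix_vector_mult_diff_distrib flip: matrix_vector_mul_assoc)
  then show thesis ..
qed

section \<open>Row and column spaces, and the rank of a product\<close>

lemma span_columns: "vec.span (columns C) = range ((*v) (C :: 'a::field^'n^'m))"
proof
  have "columns C \<subseteq> range ((*v) C)"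
    by (auto simp: columns_def column_eq_mult_axis)
  then show "vec.span (columns C) \<subseteq> range ((*v) C)"
    by (intro vec.span_minimal) (auto intro: vec.subspace_image)
qed (auto intro: matrix_vector_mult_in_columnspace_gen)

lemma span_rows: "vec.span (rows B) = range ((*v) (transpose (B :: 'a::field^'n^'m)))"
  by (metis columns_transpose span_columns)

lemma span_rows_mult: "vec.span (rows (M ** B)) \<subseteq> vec.span (rows (B :: 'a::field^'n^'m))"
  by (auto simp: span_rows matrix_transpose_mul simp flip: matrix_vector_mul_assoc)

lemma rank_mult_le: "rank (M ** B) \<le> rank (B :: 'a::field^'n^'m)"
  unfolding row_rank_def_gen by (metis span_rows_mult vec.dim_span vec.dim_subset)

text \<open>The row space of \<open>M ** B\<close> lies in that of \<open>B\<close>, and equal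
  dimension forces equality; the columnwise factorization then applies to the transposes.\<close>

lemma rank_mult_eq_left_factor:
  fixes B :: "'a::field^'n^'m" and M :: "'a^'m^'p"
  assumes "rank (M ** B) = rank B"
  obtains Z where "B = Z ** (M ** B)"
proof -
  have "vec.span (rows (M ** B)) = vec.span (rows B)"
    using assms span_rows_mult unfolding row_rank_def_gen
    by (intro vec.subspace_dim_equal) auto
  then obtain Y where "transpose B = transpose (M ** B) ** Y"
    unfolding span_rows by (metis matrix_right_factor order_refl)
  then have "B = transpose Y ** (M ** B)"
    by (metis matrix_transpose_mul transpose_transpose)
  then show thesis ..
qed

section \<open>The Moore-Penrose inverse\<close>

lemma conjugate_transpose_mult:
  "conjugate_transpose (A ** B) = conjugate_transpose B ** conjugate_transpose A"
  by (simp add: conjugate_transpose_def matrix_matrix_mult_def vec_eq_iff mult.commute)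

lemma conjugate_transpose_conjugate_transpose [simp]:
  "conjugate_transpose (conjugate_transpose A) = A"
  by (simp add: conjugate_transpose_def vec_eq_iff)

text \<open>Pairing the vanishing vector with \<open>x\<close> gives the squared norm of
  \<open>A *v x\<close>.\<close>

lemma conjugate_transpose_mult_self_ker:
  assumes "(conjugate_transpose A ** A) *v x = 0"
  shows "A *v x = 0"
proof -
  define y where "y = A *v x"
  have "conjugate_transpose A *v y = 0"
    using assms by (simp add: y_def matrix_vector_mul_assoc)
  then have "\<And>j. (\<Sum>i\<in>UNIV. cnj (A $ i $ j) * y $ i) = 0"
    by (simp add: conjugate_transpose_def matrix_vector_mult_def vec_eq_iff)
  then have "0 = (\<Sum>j\<in>UNIV. cnj (x $ j) * (\<Sum>i\<in>UNIV. cnj (A $ i $ j) * y $ i))"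
    by simp
  \<comment> \<open>Only the conjugated factor is expanded as \<open>A *v x\<close>; exchanging the
    sums then matches the two sides.\<close>
  also have "\<dots> = (\<Sum>i\<in>UNIV. cnj (y $ i) * y $ i)"
    by (subst (2) y_def)
      (simp add: matrix_vector_mult_def sum_distrib_left sum_distrib_right,
       subst sum.swap, simp add: mult_ac)
  also have "\<dots> = of_real (\<Sum>i\<in>UNIV. (norm (y $ i))\<^sup>2)"
    by (simp add: complex_norm_square mult.commute del: of_real_power)
  finally have "(\<Sum>i\<in>UNIV. (norm (y $ i))\<^sup>2) = 0"
    by (metis of_real_eq_0_iff)
  then show ?thesis
    by (simp add: sum_nonneg_eq_0_iff vec_eq_iff flip: y_def)
qed

lemma conjugate_transpose_left_factor:
  obtains Z where "A = Z ** (conjugate_transpose A ** A)"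
  using matrix_left_factor conjugate_transpose_mult_self_ker by metis

text \<open>\<open>W\<close> makes \<open>A ** W\<close> self-adjoint, \<open>V\<close> makes
  \<open>V ** A\<close> self-adjoint, and both are inner inverses of \<open>A\<close>; the product
  \<open>V ** A ** W\<close> inherits both symmetries.\<close>

lemma is_moore_penrose_inverse_exists: "\<exists>X. is_moore_penrose_inverse A X"
proof -
  let ?H = conjugate_transpose
  obtain Z where Z: "A = Z ** (?H A ** A)"
    by (rule conjugate_transpose_left_factor)
  obtain V where V: "?H A = V ** (A ** ?H A)"
    by (metis conjugate_transpose_left_factor conjugate_transpose_conjugate_transpose)
  define W where "W = ?H Z"
  have "A ** W = Z ** (?H A ** A) ** ?H Z"
    unfolding W_def by (rule arg_cong[OF Z])
  then have AW: "?H (A ** W) = A ** W"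
    by (simp add: conjugate_transpose_mult matrix_mul_assoc)
  \<comment> \<open>Self-adjointness gives \<open>A W = Z (?H A)\<close>, so the choice of
    \<open>Z\<close> applies.\<close>
  have "A ** W ** A = A"
    using AW Z by (metis W_def conjugate_transpose_conjugate_transpose conjugate_transpose_mult
        matrix_mul_assoc)
  have "A = A ** ?H A ** ?H V"
    using V by (metis conjugate_transpose_conjugate_transpose conjugate_transpose_mult)
  then have "V ** A = V ** (A ** ?H A ** ?H V)"
    by (rule arg_cong)
  then have VA: "?H (V ** A) = V ** A"
    by (metis conjugate_transpose_conjugate_transpose conjugate_transpose_mult matrix_mul_assoc)
  have "A ** V ** A = A"
    using VA \<open>A = A ** ?H A ** ?H V\<close> by (metis conjugate_transpose_mult matrix_mul_assoc)
  have "A ** (V ** A ** W) = A ** W" "(V ** A ** W) ** A = V ** A"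
    using \<open>A ** W ** A = A\<close> \<open>A ** V ** A = A\<close> by (metis matrix_mul_assoc)+
  moreover have "V ** A ** (V ** A ** W) = V ** A ** W"
    using \<open>A ** V ** A = A\<close> by (metis matrix_mul_assoc)
  ultimately have "is_moore_penrose_inverse A (V ** A ** W)"
    unfolding is_moore_penrose_inverse_def using AW VA \<open>A ** W ** A = A\<close> by simp
  then show ?thesis ..
qed

text \<open>Taking adjoints in \<open>A X = (A Y) (A X)\<close> gives
  \<open>A X = (A X) (A Y) = A Y\<close>; similarly \<open>X A = Y A\<close>. Then
  \<open>X = X A X = Y A Y = Y\<close>.\<close>

lemma is_moore_penrose_inverse_unique:
  assumes X: "is_moore_penrose_inverse A X" and Y: "is_moore_penrose_inverse A Y"
  shows "X = Y"
proof -
  have "A ** X = A ** Y"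
    using X Y unfolding is_moore_penrose_inverse_def
    by (metis conjugate_transpose_mult matrix_mul_assoc)
  moreover have "X ** A = Y ** A"
    using X Y unfolding is_moore_penrose_inverse_def
    by (metis conjugate_transpose_mult matrix_mul_assoc)
  ultimately show ?thesis
    using X Y unfolding is_moore_penrose_inverse_def by (metis matrix_mul_assoc)
qed

lemma moore_penrose_inverse: "is_moore_penrose_inverse A (moore_penrose_inverse A)"
  unfolding moore_penrose_inverse_def
  by (rule theI') (metis is_moore_penrose_inverse_exists is_moore_penrose_inverse_unique)

section \<open>The Drazin inverse\<close>

lemma matpow_add: "matpow A (m + n) = matpow A m ** matpow A n"
  by (induction m) (simp_all add: matrix_mul_assoc)

lemma matpow_commutes: "A ** X = X ** A \<Longrightarrow> matpow A n ** X = X ** matpow A n"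
  by (induction n) (simp_all, metis matrix_mul_assoc)

lemma matpow_Suc_right: "matpow A (Suc n) = matpow A n ** A"
  by (simp add: matpow_commutes)

text \<open>The ranks of the powers are non-increasing naturals, so they cannot drop forever and the
  \<open>LEAST\<close> in the index is attained.\<close>

lemma rank_matpow_index:
  "rank (matpow A (Suc (matrix_index A))) = rank (matpow A (matrix_index A))"
proof -
  let ?r = "\<lambda>k. rank (matpow A k)"
  have "\<exists>k. ?r k = ?r (k + 1)"
  proof (rule ccontr)
    assume "\<nexists>k. ?r k = ?r (k + 1)"
    then have "?r (k + 1) \<noteq> ?r k" for k
      by metis
    moreover have "?r (k + 1) \<le> ?r k" for k
      using rank_mult_le[of A "matpow A k"] by simp
    ultimately have "(?r (Suc k), ?r k) \<in> {(x, y). x < y}" for k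
      by (simp add: le_neq_implies_less)
    then show False
      using wf_no_infinite_down_chainE[OF wf_less, of ?r] by blast
  qed
  then have "?r (matrix_index A) = ?r (matrix_index A + 1)"
    unfolding matrix_index_def by (rule LeastI_ex)
  then show ?thesis
    by simp
qed

text \<open>Equal ranks give \<open>Z1\<close> with \<open>A^k = Z1 A^(k+1)\<close>; multiplying by
  \<open>A^m\<close> on the right raises the exponent one step at a time.\<close>

lemma matpow_index_left_factor:
  "\<exists>Z. matpow A (matrix_index A) = Z ** matpow A (matrix_index A + m)"
proof (induction m)
  case (Suc m)
  let ?k = "matrix_index A"
  obtain Z where Z: "matpow A ?k = Z ** matpow A (?k + m)"
    using Suc by blast
  obtain Z1 where "matpow A ?k = Z1 ** matpow A (Suc ?k)"
    using rank_matpow_index rank_mult_eq_left_factor by (metis matpow.simps(2))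
  then have "matpow A (?k + m) = Z1 ** matpow A (?k + Suc m)"
    by (metis add_Suc_shift matpow_add matrix_mul_assoc)
  then show ?case
    using Z by (metis matrix_mul_assoc)
qed (metis add_0_right matrix_mul_lid)

text \<open>The left factor makes \<open>A^m\<close> injective on the range \<open>V\<close> of
  \<open>A^k\<close>. It maps \<open>V\<close> into itself, so by dimension it is onto
  \<open>V\<close>, and \<open>A^(k+m)\<close> has range \<open>V\<close> as well.\<close>

lemma matpow_index_right_factor:
  "\<exists>Y. matpow A (matrix_index A) = matpow A (matrix_index A + m) ** Y"
proof -
  let ?k = "matrix_index A"
  define V where "V = range ((*v) (matpow A ?k))"
  obtain Z where Z: "matpow A ?k = Z ** matpow A (?k + m)"
    using matpow_index_left_factor by blast
  have image: "(*v) (matpow A m) ` V = range ((*v) (matpow A (?k + m)))"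
    by (simp add: V_def image_image matrix_vector_mul_assoc add.commute flip: matpow_add)
  have V: "vec.subspace V"
    unfolding V_def by (intro vec.subspace_image) simp
  have "inj_on ((*v) (matpow A m)) V"
    unfolding V_def inj_on_def
    by (clarsimp simp: matrix_vector_mul_assoc)
      (metis Z add.commute matpow_add matrix_vector_mul_assoc)
  then have "vec.dim ((*v) (matpow A m) ` V) = vec.dim V"
    using V by (intro vec.dim_image_eq) (simp_all add: vec.span_eq_iff[THEN iffD2])
  moreover have "(*v) (matpow A m) ` V \<subseteq> V"
    by (subst image) (auto simp: V_def matpow_add simp flip: matrix_vector_mul_assoc)
  ultimately have "(*v) (matpow A m) ` V = V"
    using V by (intro vec.subspace_dim_equal) (auto intro: vec.subspace_image)
  then show ?thesis
    using matrix_right_factor image V_def by (metis order_refl)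
qed

lemma is_drazin_inverse_exists: "\<exists>X. is_drazin_inverse A X"
proof -
  let ?k = "matrix_index A"
  let ?P = "matpow A ?k"
  \<comment> \<open>The exponent \<open>2k+1\<close> makes \<open>?R\<close> equal to both
    \<open>?P A ?P\<close> and \<open>A^(k+1) ?P\<close>, the products met in \<open>D A D\<close>
    and \<open>A^(k+1) D\<close>.\<close>
  let ?R = "matpow A (?k + Suc ?k)"
  obtain Y where Y: "?P = ?R ** Y"
    using matpow_index_right_factor by blast
  obtain Z where Z: "?P = Z ** ?R"
    using matpow_index_left_factor by blast
  have R1: "?R = ?P ** A ** ?P"
    by (simp only: matpow_add matpow.simps matrix_mul_assoc)
  have R2: "?R = matpow A (?k + 1) ** ?P"
    by (simp only: flip: matpow_add) simp
  define D where "D = ?P ** Y"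
  \<comment> \<open>Both sides equal \<open>Z ?R Y\<close>.\<close>
  have D: "D = Z ** ?P"
    unfolding D_def using Y Z by (metis matrix_mul_assoc)
  have "A ** ?R = ?R ** A" "A ** ?P = ?P ** A"
    by (rule matpow_commutes[symmetric], rule refl)+
  \<comment> \<open>To move \<open>A\<close> across \<open>D\<close>, \<open>?P\<close> is expanded
    to \<open>Z ?R\<close>, \<open>A\<close> passes the power \<open>?R\<close>, and
    \<open>?R Y\<close> collapses to \<open>?P\<close>.\<close>
  have "A ** D = ?P ** A ** Y"
    by (simp add: D_def \<open>A ** ?P = ?P ** A\<close> matrix_mul_assoc)
  also have "\<dots> = Z ** ?R ** A ** Y"
    by (subst (1) Z) (rule refl)
  also have "\<dots> = Z ** A ** (?R ** Y)"
    using \<open>A ** ?R = ?R ** A\<close> by (metis matrix_mul_assoc)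
  also have "\<dots> = Z ** A ** ?P"
    by (simp only: Y[symmetric])
  also have "\<dots> = D ** A"
    using \<open>A ** ?P = ?P ** A\<close> by (metis D matrix_mul_assoc)
  finally have "A ** D = D ** A" .
  moreover have "D ** A ** D = Z ** ?R ** Y"
    by (subst D, subst D_def) (simp only: R1 matrix_mul_assoc)
  then have "D ** A ** D = D"
    by (simp only: Z[symmetric] D_def)
  moreover have "matpow A (?k + 1) ** D = ?P"
    unfolding D_def using R2 Y by (metis matrix_mul_assoc)
  ultimately show ?thesis
    unfolding is_drazin_inverse_def by blast
qed

text \<open>Commutation turns \<open>X A X = X\<close> into \<open>X = A X X = X X A\<close>;
  substituting the factorization for the middle \<open>X\<close> gains one power of \<open>A\<close>
  on either side.\<close>

lemma outer_inverse_matpow_factor: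
  assumes "X ** A ** X = X" "A ** X = X ** A"
  shows "\<exists>S T. X = matpow A m ** S \<and> X = T ** matpow A m"
proof (induction m)
  case 0
  show ?case by simp
next
  case (Suc m)
  then obtain S T where S: "X = matpow A m ** S" and T: "X = T ** matpow A m"
    by blast
  have "X = A ** X ** X" "X = X ** X ** A"
    using assms by (metis matrix_mul_assoc)+
  then have "X = matpow A (Suc m) ** (S ** X)" "X = (X ** T) ** matpow A (Suc m)"
    unfolding matpow_Suc_right[of A m] using S T matpow_Suc_right[of A m]
    by (metis matpow.simps(2) matrix_mul_assoc)+
  then show ?case by blast
qed

text \<open>Both matrices equal \<open>X A Y\<close>: \<open>X\<close> ends in \<open>A^k\<close>,
  which \<open>A Y\<close> fixes from the right, and \<open>Y\<close> begins with
  \<open>A^k\<close>, which \<open>X A\<close> fixes from the left.\<close>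

lemma is_drazin_inverse_unique:
  assumes X: "is_drazin_inverse A X" and Y: "is_drazin_inverse A Y"
  shows "X = Y"
proof -
  let ?k = "matrix_index A"
  obtain T where T: "X = T ** matpow A ?k"
    using outer_inverse_matpow_factor X unfolding is_drazin_inverse_def by metis
  obtain S where S: "Y = matpow A ?k ** S"
    using outer_inverse_matpow_factor Y unfolding is_drazin_inverse_def by metis
  have "matpow A ?k = matpow A ?k ** A ** Y"
    using Y unfolding is_drazin_inverse_def by (metis Suc_eq_plus1 matpow_Suc_right)
  then have "X = X ** A ** Y"
    using T by (metis matrix_mul_assoc)
  have "matpow A ?k = X ** matpow A (?k + 1)"
    using X unfolding is_drazin_inverse_def by (metis matpow_commutes)
  then have "Y = X ** A ** Y"
    using S by (metis Suc_eq_plus1 matpow.simps(2) matrix_mul_assoc)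
  then show ?thesis
    using \<open>X = X ** A ** Y\<close> by simp
qed

lemma drazin_inverse: "is_drazin_inverse A (drazin_inverse A)"
  unfolding drazin_inverse_def
  by (rule theI') (metis is_drazin_inverse_exists is_drazin_inverse_unique)

theorem theorem2:
  fixes A :: "complex^'n^'n"
  shows "\<forall>X :: complex^'n^'n.
    (X ** matpow A 3 ** X = X \<and>
     A ** X = drazin_inverse A ** moore_penrose_inverse A \<and>
     X ** A = moore_penrose_inverse A ** drazin_inverse A)
    \<longleftrightarrow> X = moore_penrose_inverse A ** drazin_inverse A ** moore_penrose_inverse A"
proof -
  define P where "P = moore_penrose_inverse A"
  define D where "D = drazin_inverse A"
  have APA: "A ** P ** A = A"
    using moore_penrose_inverse[of A] by (simp add: P_def is_moore_penrose_inverse_def)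
  have DAD: "D ** A ** D = D" and AD: "A ** D = D ** A"
    using drazin_inverse[of A] by (simp_all add: D_def is_drazin_inverse_def)
  \<comment> \<open>Since \<open>D = A D D = D D A\<close>, the equation \<open>A P A = A\<close>
    cancels \<open>A P\<close> before \<open>D\<close> and \<open>P A\<close> after it.\<close>
  have APD: "A ** P ** D = D" and DPA: "D ** P ** A = D"
    using APA DAD AD by (metis matrix_mul_assoc)+
  \<comment> \<open>This grouping exposes \<open>X A\<close> and \<open>A X\<close>, so the same
    product \<open>core\<close> serves both directions of the equivalence.\<close>
  have cube: "X ** matpow A 3 ** X = (X ** A) ** A ** (A ** X)" for X
    by (simp add: numeral_3_eq_3 matrix_mul_assoc)
  have core: "(P ** D) ** A ** (D ** P) = P ** D ** P"
    using DAD by (metis matrix_mul_assoc)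
  have "A ** (P ** D ** P) = D ** P" "(P ** D ** P) ** A = P ** D"
    using APD DPA by (metis matrix_mul_assoc)+
  then show ?thesis
    unfolding cube P_def[symmetric] D_def[symmetric] using core by metis
qed

end
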